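(* Let $A$ be a finite-dimensional real alternative algebra with unity and a fixed antiinvolution, with $\mathbb{S}_A\neq\emptyset$. Let $J,K\in\mathbb{S}_A$ with $J-K$ invertible in $A$. Every slice function $f$ on $\Omega_D$ is uniquely determined (among slice functions on $\Omega_D$) by its values on the two distinct half planes $\mathbb{C}_J^+$ and $\mathbb{C}_K^+$ (i.e. by its restrictions to $\mathbb{C}_J^+\cap\Omega_D$ and $\mathbb{C}_K^+\cap\Omega_D$). In particular, taking $K=-J$, $f$ is uniquely determined by its values on a complex plane $\mathbb{C}_J$.
   Context: Setting. $A$ is a finite-dimensional real alternative algebra with unity, of real dimension $d>1$ (alternative: the associator $(x,y,z)=(xy)z-x(yz)$ is alternating); $\mathbb{R}$ is identified with $\mathbb{R}\cdot 1\subseteq A$. An antiinvolution $x\mapsto x^c$ is fixed: a linear map with $(x^c)^c=x$, $(xy)^c=y^cx^c$, and $x^c=x$ for $x\in\mathbb{R}$. Put $t(x)=x+x^c$, $n(x)=xx^c$. Quadratic cone: $Q_A=\mathbb{R}\cup\{x\in A\mid t(x)\in\mathbb{R},\ n(x)\in\mathbb{R},\ 4n(x)>t(x)^2\}$. $\mathbb{S}_A=\{J\in Q_A\mid J^2=-1\}$, assumed non-empty. For $J\in\mathbb{S}_A$, $\mathbb{C}_J=\langle 1,J\rangle\simeq\mathbb{C}$ and $\mathbb{C}_J^+=\{\alpha+\beta J\mid\alpha,\beta\in\mathbb{R},\ \beta\geq0\}$. Slice functions. $A_{\mathbb{C}}=A\otimes_{\mathbb{R}}\mathbb{C}=\{x+iy\mid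 x,y\in A\}$ with conjugation $\overline{x+iy}=x-iy$. $D\subseteq\mathbb{C}$ is open and, without restriction, invariant under complex conjugation. A stem function on $D$ is $F=F_1+iF_2:D\to A_{\mathbb{C}}$ ($F_1,F_2$ $A$-valued) with $F(\bar z)=\overline{F(z)}$. Let $\Omega_D=\{\alpha+\beta J\mid \alpha,\beta\in\mathbb{R},\ \alpha+i\beta\in D,\ J\in\mathbb{S}_A\}$. The (left) slice function $f=\mathcal{I}(F):\Omega_D\to A$ induced by $F$ is $f(\alpha+\beta J)=F_1(\alpha+i\beta)+JF_2(\alpha+i\beta)$. *)

theory Defs
  imports Complex_Main
begin

text \<open>
  The library classes \<open>real_algebra\<close> and \<open>real_algebra_1\<close> are associative, so unital algebras
  without associativity get their own class. The real numbers sit inside the algebra as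
  \<open>r *\<^sub>R 1\<close>.
\<close>

class real_nonassoc_algebra_1 = real_vector + times + one +
  assumes nonassoc_distrib_left: "x * (y + z) = x * y + x * z"
    and nonassoc_distrib_right: "(x + y) * z = x * z + y * z"
    and nonassoc_scaleR_left: "(r *\<^sub>R x) * y = r *\<^sub>R (x * y)"
    and nonassoc_scaleR_right: "x * (r *\<^sub>R y) = r *\<^sub>R (x * y)"
    and nonassoc_one_left: "1 * x = x"
    and nonassoc_one_right: "x * 1 = x"
begin

definition associator :: "'a \<Rightarrow> 'a \<Rightarrow> 'a \<Rightarrow> 'a"
  where "associator x y z = (x * y) * z - x * (y * z)"

end

text \<open>The associator is trilinear; alternating means it vanishes when two arguments coincide.\<close>

class real_alternative_algebra_1 = real_nonassoc_algebra_1 +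
  assumes associator_left: "associator x x y = 0"
    and associator_right: "associator x y y = 0"
    and associator_flexible: "associator x y x = 0"

subclass (in real_algebra_1) real_nonassoc_algebra_1
  by standard (simp_all add: distrib_left distrib_right)

subclass (in real_algebra_1) real_alternative_algebra_1
  by standard (simp_all add: associator_def mult.assoc)

definition finite_dimensional :: "'a::real_vector itself \<Rightarrow> bool"
  where "finite_dimensional _ \<longleftrightarrow> (\<exists>B::'a set. finite B \<and> span B = UNIV)"

definition real_line :: "'a::real_nonassoc_algebra_1 set"
  where "real_line = range (\<lambda>r. r *\<^sub>R 1)"

definition unit_elem :: "'a::real_nonassoc_algebra_1 \<Rightarrow> bool"
  where "unit_elem x \<longleftrightarrow> (\<exists>y. x * y = 1 \<and> y * x = 1)"

definition antiinvolution :: "('a::real_nonassoc_algebra_1 \<Rightarrow> 'a) \<Rightarrow> bool"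
  where "antiinvolution c \<longleftrightarrow>
    linear c \<and> (\<forall>x. c (c x) = x) \<and> (\<forall>x y. c (x * y) = c y * c x) \<and> (\<forall>x\<in>real_line. c x = x)"

definition trace :: "('a::real_nonassoc_algebra_1 \<Rightarrow> 'a) \<Rightarrow> 'a \<Rightarrow> 'a"
  where "trace c x = x + c x"

definition sqnorm :: "('a::real_nonassoc_algebra_1 \<Rightarrow> 'a) \<Rightarrow> 'a \<Rightarrow> 'a"
  where "sqnorm c x = x * c x"

definition quadratic_cone :: "('a::real_nonassoc_algebra_1 \<Rightarrow> 'a) \<Rightarrow> 'a set"
  where "quadratic_cone c = real_line \<union>
    {x. \<exists>t n. trace c x = t *\<^sub>R 1 \<and> sqnorm c x = n *\<^sub>R 1 \<and> 4 * n > t\<^sup>2}"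

definition imag_sphere :: "('a::real_nonassoc_algebra_1 \<Rightarrow> 'a) \<Rightarrow> 'a set"
  where "imag_sphere c = {J \<in> quadratic_cone c. J * J = - 1}"

definition slice_plane :: "'a::real_nonassoc_algebra_1 \<Rightarrow> 'a set"
  where "slice_plane J = span {1, J}"

definition slice_half_plane :: "'a::real_nonassoc_algebra_1 \<Rightarrow> 'a set"
  where "slice_half_plane J = {\<alpha> *\<^sub>R 1 + \<beta> *\<^sub>R J | \<alpha> \<beta>. \<beta> \<ge> 0}"

text \<open>
  The pair \<open>(x, y)\<close> stands for the element \<open>x + \<i>y\<close> of \<open>A \<otimes> \<complex>\<close>. Only the conjugation of the
  complexification is needed, not its product.
\<close>

type_synonym 'a complexification = "'a \<times> 'a"

definition complexification_cnj :: "'a::real_vector complexification \<Rightarrow> 'a complexification"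
  where "complexification_cnj w = (fst w, - snd w)"

definition stem_function :: "complex set \<Rightarrow> (complex \<Rightarrow> 'a::real_vector complexification) \<Rightarrow> bool"
  where "stem_function D F \<longleftrightarrow> (\<forall>z\<in>D. F (cnj z) = complexification_cnj (F z))"

definition slice_domain :: "('a::real_nonassoc_algebra_1 \<Rightarrow> 'a) \<Rightarrow> complex set \<Rightarrow> 'a set"
  where "slice_domain c D =
    {\<alpha> *\<^sub>R 1 + \<beta> *\<^sub>R J | \<alpha> \<beta> J. Complex \<alpha> \<beta> \<in> D \<and> J \<in> imag_sphere c}"

text \<open>
  A function \<open>\<Omega>\<^sub>D \<rightarrow> A\<close> is represented by a total function whose values off \<open>\<Omega>\<^sub>D\<close> are irrelevant.
  The defining equation is required for every representation \<open>\<alpha> + \<beta>J\<close> of a point of \<open>\<Omega>\<^sub>D\<close>.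
\<close>

definition induced_by ::
  "('a::real_nonassoc_algebra_1 \<Rightarrow> 'a) \<Rightarrow> complex set \<Rightarrow> (complex \<Rightarrow> 'a complexification) \<Rightarrow>
    ('a \<Rightarrow> 'a) \<Rightarrow> bool"
  where "induced_by c D F f \<longleftrightarrow>
    (\<forall>\<alpha> \<beta>. \<forall>J\<in>imag_sphere c. Complex \<alpha> \<beta> \<in> D \<longrightarrow>
      f (\<alpha> *\<^sub>R 1 + \<beta> *\<^sub>R J) = fst (F (Complex \<alpha> \<beta>)) + J * snd (F (Complex \<alpha> \<beta>)))"

definition slice_function ::
  "('a::real_nonassoc_algebra_1 \<Rightarrow> 'a) \<Rightarrow> complex set \<Rightarrow> ('a \<Rightarrow> 'a) \<Rightarrow> bool"
  where "slice_function c D f \<longleftrightarrow> (\<exists>F. stem_function D F \<and> induced_by c D F f)"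

end

theory Submission
  imports Defs
begin

text \<open>
  At \<open>z = \<alpha> + i\<beta>\<close> with \<open>\<beta> \<ge> 0\<close>, the values of a slice function at \<open>\<alpha> + \<beta>J\<close> and \<open>\<alpha> + \<beta>K\<close> differ by
  \<open>(J - K) F\<^sub>2(z)\<close>. An invertible element of an alternative algebra is not a left zero divisor, so
  these two values determine \<open>F\<^sub>2(z)\<close> and then \<open>F\<^sub>1(z)\<close>; the stem condition covers \<open>\<beta> < 0\<close>.
\<close>

section \<open>Arithmetic without associativity and cancellation of invertible elements\<close>

lemma linear_times_left: "linear (\<lambda>y. x * (y::'a::real_nonassoc_algebra_1))"
  by (rule linearI) (simp_all add: nonassoc_distrib_left nonassoc_scaleR_right)

lemma linear_times_right: "linear (\<lambda>x. x * (y::'a::real_nonassoc_algebra_1))"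
  by (rule linearI) (simp_all add: nonassoc_distrib_right nonassoc_scaleR_left)

text \<open>Linearity of both multiplications supplies the rules for zero, negation and subtraction
  that the class axioms leave implicit.\<close>

lemmas nonassoc_times_simps =
  linear_0[OF linear_times_left] linear_0[OF linear_times_right]
  linear_neg[OF linear_times_left] linear_neg[OF linear_times_right]
  linear_diff[OF linear_times_left] linear_diff[OF linear_times_right]
  nonassoc_distrib_left nonassoc_distrib_right
  nonassoc_scaleR_left nonassoc_scaleR_right
  nonassoc_one_left nonassoc_one_right

lemma left_alternative: "x * (x * y) = (x * x) * (y::'a::real_alternative_algebra_1)"
  using associator_left[of x y] by (simp add: associator_def)

lemma right_alternative: "(x * y) * y = x * (y * (y::'a::real_alternative_algebra_1))"
  using associator_right[of x y] by (simp add: associator_def)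

text \<open>Polarization: expand the left alternative law at \<open>x + y\<close> and cancel its
  instances at \<open>x\<close> and \<open>y\<close>.\<close>

lemma left_alternative_linearized:
  fixes x y z :: "'a::real_alternative_algebra_1"
  shows "x * (y * z) + y * (x * z) = (x * y + y * x) * z"
  using left_alternative[of "x + y" z] left_alternative[of x z] left_alternative[of y z]
  by (simp add: nonassoc_times_simps algebra_simps)

text \<open>
  With \<open>u\<close> inverse to \<open>x\<close>, the linearized left alternative law for the pairs \<open>(u, x)\<close> and
  \<open>(u\<^sup>2, x)\<close> gives \<open>L\<^sub>uL\<^sub>x + L\<^sub>xL\<^sub>u = 2\<close> and \<open>L\<^sub>u\<^sup>2L\<^sub>x + L\<^sub>xL\<^sub>u\<^sup>2 = 2L\<^sub>u\<close> for the left
  multiplications.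
\<close>

lemma unit_elem_times_eq_0:
  fixes x y :: "'a::real_alternative_algebra_1"
  assumes "unit_elem x" "x * y = 0"
  shows "y = 0"
proof -
  obtain u where u: "x * u = 1" "u * x = 1"
    using assms(1) by (auto simp: unit_elem_def)
  have anti: "u * (x * z) + x * (u * z) = z + z" for z
    using left_alternative_linearized[of u x z] by (simp add: u nonassoc_times_simps)
  have xuy: "x * (u * y) = y + y"
    using anti[of y] by (simp add: assms nonassoc_times_simps)
  have "(u * u) * x = u" "x * (u * u) = u"
    using left_alternative[of u x] right_alternative[of x u] by (simp_all add: u nonassoc_times_simps)
  then have "x * (u * (u * y)) = u * y + u * y"
    using left_alternative_linearized[of "u * u" x y]
    by (simp add: assms nonassoc_times_simps left_alternative)
  \<comment> \<open>Both summands of \<open>anti\<close> at \<open>u * y\<close> are now known. As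
    \<open>x * (u * y) = y + y\<close>, the vanishing of the first gives \<open>u * y = 0\<close>,
    which turns \<open>xuy\<close> into \<open>y + y = 0\<close>.\<close>
  then have "u * (x * (u * y)) = 0"
    using anti[of "u * y"] by simp
  then have "2 *\<^sub>R (u * y) = 0"
    by (simp add: xuy nonassoc_times_simps scaleR_2)
  then have "y + y = 0"
    using xuy by (simp add: nonassoc_times_simps)
  then have "2 *\<^sub>R y = 0"
    by (simp only: scaleR_2)
  then show ?thesis
    by simp
qed

section \<open>Square roots of -1 and their half planes\<close>

text \<open>Rules out the zero algebra, where \<open>J = 0\<close> would satisfy
  \<open>J * J = - 1\<close>.\<close>

lemma one_neq_zero_if_dim:
  assumes "dim (UNIV :: 'a::real_nonassoc_algebra_1 set) > 0"
  shows "(1::'a) \<noteq> 0"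
proof
  assume "(1::'a) = 0"
  then have "x = 0" for x :: 'a
    using nonassoc_one_left[of x] by (simp add: nonassoc_times_simps)
  then have "(UNIV :: 'a set) \<subseteq> span {}"
    by auto
  then have "dim (UNIV :: 'a set) = 0"
    using dim_le_card[of "UNIV :: 'a set" "{}"] by simp
  then show False
    using assms by simp
qed

lemma sqrt_minus_one_notin_real_line:
  fixes J :: "'a::real_nonassoc_algebra_1"
  assumes "(1::'a) \<noteq> 0" "J * J = - 1"
  shows "J \<noteq> r *\<^sub>R 1"
proof
  assume "J = r *\<^sub>R 1"
  then have "(r * r + 1) *\<^sub>R (1::'a) = 0"
    using assms(2) by (simp add: nonassoc_times_simps scaleR_add_left)
  then have "r * r + 1 = 0"
    using assms(1) by simp
  then show False
    using zero_le_square[of r] by linarith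
qed

text \<open>Compare the square of \<open>J = a + bK\<close> with -1. As \<open>K\<close> is not
  real, \<open>2ab\<close> vanishes; as \<open>J\<close> is not real, \<open>b\<close> is nonzero.
  Hence \<open>a = 0\<close> and \<open>b * b = 1\<close>, and the sign condition on
  \<open>b\<close> excludes \<open>J = - K\<close>.\<close>

lemma sqrt_minus_one_in_slice_half_plane:
  fixes J K :: "'a::real_nonassoc_algebra_1"
  assumes one: "(1::'a) \<noteq> 0" and J: "J * J = - 1" and K: "K * K = - 1"
    and mem: "J \<in> slice_half_plane K"
  shows "J = K"
proof -
  obtain a b where ab: "J = a *\<^sub>R 1 + b *\<^sub>R K" "b \<ge> 0"
    using mem by (auto simp: slice_half_plane_def)
  have "b \<noteq> 0"
    using ab sqrt_minus_one_notin_real_line[OF one J, of a] by auto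
  have "J * J = (a * a - b * b) *\<^sub>R 1 + (2 * a * b) *\<^sub>R K"
    by (simp add: ab nonassoc_times_simps K algebra_simps flip: scaleR_2)
  then have eq: "(2 * a * b) *\<^sub>R K = (b * b - a * a - 1) *\<^sub>R 1"
    using J by (simp add: algebra_simps)
  have "a = 0"
  proof (rule ccontr)
    assume "a \<noteq> 0"
    with \<open>b \<noteq> 0\<close> have "K = inverse (2 * a * b) *\<^sub>R ((2 * a * b) *\<^sub>R K)"
      by (simp add: field_simps)
    also have "\<dots> = (inverse (2 * a * b) * (b * b - a * a - 1)) *\<^sub>R 1"
      by (simp only: eq scaleR_scaleR)
    finally show False
      using sqrt_minus_one_notin_real_line[OF one K] by blast
  qed
  with eq one have "b * b = 1"
    by simp
  with \<open>b \<ge> 0\<close> have "b = 1"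
    using square_eq_1_iff[of b] by auto
  with ab \<open>a = 0\<close> show ?thesis
    by simp
qed

lemma slice_half_plane_inject:
  fixes J K :: "'a::real_nonassoc_algebra_1"
  assumes "(1::'a) \<noteq> 0" "J * J = - 1" "K * K = - 1"
    and "slice_half_plane J = slice_half_plane K"
  shows "J = K"
proof (rule sqrt_minus_one_in_slice_half_plane)
  have "J = 0 *\<^sub>R 1 + 1 *\<^sub>R J"
    by simp
  then have "J \<in> slice_half_plane J"
    unfolding slice_half_plane_def using zero_le_one by blast
  then show "J \<in> slice_half_plane K"
    using assms(4) by simp
qed fact+

section \<open>From values on two half planes to stem functions\<close>

lemma times_determined_by_two_values:
  fixes a a' b b' :: "'a::real_alternative_algebra_1"
  assumes "unit_elem (J - K)"
    and J: "a + J * b = a' + J * b'" and K: "a + K * b = a' + K * b'"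
  shows "a = a' \<and> b = b'"
proof -
  have "(J - K) * (b - b') = (a + J * b - (a' + J * b')) - (a + K * b - (a' + K * b'))"
    by (simp add: nonassoc_times_simps algebra_simps)
  then have "(J - K) * (b - b') = 0"
    using J K by simp
  then have "b - b' = 0"
    by (rule unit_elem_times_eq_0[OF assms(1)])
  then show ?thesis
    using J by simp
qed

text \<open>Half planes only see the part of \<open>D\<close> with \<open>Im z \<ge> 0\<close>.
  Below the real axis, pass to \<open>cnj z\<close> and use that conjugation on the complexification
  is injective.\<close>

lemma slice_functions_eq_if_stems_eq:
  assumes D: "\<forall>z\<in>D. cnj z \<in> D"
    and F: "stem_function D F" "induced_by c D F f"
    and G: "stem_function D G" "induced_by c D G g"
    and eq: "\<And>z. z \<in> D \<Longrightarrow> Im z \<ge> 0 \<Longrightarrow> F z = G z"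
    and x: "x \<in> slice_domain c D"
  shows "f x = g x"
proof -
  have FG: "F z = G z" if z: "z \<in> D" for z
  proof (cases "Im z \<ge> 0")
    case False
    then have "F (cnj z) = G (cnj z)"
      using D z eq by simp
    then have "complexification_cnj (F z) = complexification_cnj (G z)"
      using F(1) G(1) z by (simp add: stem_function_def)
    then show ?thesis
      by (simp add: complexification_cnj_def prod_eq_iff)
  qed (use z eq in blast)
  obtain a b J where "x = a *\<^sub>R 1 + b *\<^sub>R J" "Complex a b \<in> D" "J \<in> imag_sphere c"
    using x by (auto simp: slice_domain_def)
  then show ?thesis
    using F(2) G(2) FG by (simp add: induced_by_def)
qed

lemma slice_functions_eq_if_eq_on_half_planes:
  fixes c :: "'a::real_alternative_algebra_1 \<Rightarrow> 'a"
  assumes D: "\<forall>z\<in>D. cnj z \<in> D"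
    and JK: "J \<in> imag_sphere c" "K \<in> imag_sphere c" "unit_elem (J - K)"
    and fg: "slice_function c D f" "slice_function c D g"
    and eqJ: "\<forall>x\<in>slice_half_plane J \<inter> slice_domain c D. f x = g x"
    and eqK: "\<forall>x\<in>slice_half_plane K \<inter> slice_domain c D. f x = g x"
    and x: "x \<in> slice_domain c D"
  shows "f x = g x"
proof -
  obtain F G where F: "stem_function D F" "induced_by c D F f"
    and G: "stem_function D G" "induced_by c D G g"
    using fg by (auto simp: slice_function_def)
  show ?thesis
  proof (rule slice_functions_eq_if_stems_eq[OF D F G _ x])
    fix z assume z: "z \<in> D" "Im z \<ge> 0"
    have value_eq: "fst (F z) + I * snd (F z) = fst (G z) + I * snd (G z)"
      if I: "I \<in> imag_sphere c" and eq: "\<forall>x\<in>slice_half_plane I \<inter> slice_domain c D. f x = g x" for I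
    proof -
      \<comment> \<open>Since \<open>Im z \<ge> 0\<close>, this point over \<open>z\<close> lies in
        the half plane of \<open>I\<close>. Taking \<open>I\<close> to be \<open>J\<close> and then
        \<open>K\<close> gives two equations at the same \<open>z\<close>.\<close>
      let ?p = "Re z *\<^sub>R 1 + Im z *\<^sub>R I"
      have "?p \<in> slice_half_plane I" "?p \<in> slice_domain c D"
        using z I complex.collapse[of z]
        unfolding slice_half_plane_def slice_domain_def by fastforce+
      then have "f ?p = g ?p"
        using eq by blast
      then show ?thesis
        using F(2) G(2) I z by (simp add: induced_by_def)
    qed
    show "F z = G z"
      using times_determined_by_two_values[OF JK(3) value_eq[OF JK(1) eqJ] value_eq[OF JK(2) eqK]]
      by (simp add: prod_eq_iff)
  qed
qed

section \<open>Opposite imaginary units and the whole plane\<close>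

text \<open>Makes \<open>K = - J\<close> admissible: negation flips the trace and fixes the norm, so
  \<open>4 * n > t\<^sup>2\<close> persists.\<close>

lemma uminus_imag_sphere:
  fixes c :: "'a::real_nonassoc_algebra_1 \<Rightarrow> 'a"
  assumes c: "antiinvolution c" and J: "J \<in> imag_sphere c"
  shows "- J \<in> imag_sphere c"
proof -
  have neg: "c (- x) = - c x" for x
    using c linear_neg by (auto simp: antiinvolution_def)
  have "- J \<in> quadratic_cone c"
  proof (cases "J \<in> real_line")
    case True
    then obtain r where "J = r *\<^sub>R 1"
      by (auto simp: real_line_def)
    then have "- J = (- r) *\<^sub>R 1"
      by simp
    then show ?thesis
      unfolding quadratic_cone_def real_line_def by blast
  next
    case False
    then obtain t n where "trace c J = t *\<^sub>R 1" "sqnorm c J = n *\<^sub>R 1" "4 * n > t\<^sup>2"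
      using J by (auto simp: imag_sphere_def quadratic_cone_def)
    moreover have "trace c (- J) = - trace c J" "sqnorm c (- J) = sqnorm c J"
      by (simp_all add: trace_def sqnorm_def neg nonassoc_times_simps)
    ultimately have "trace c (- J) = (- t) *\<^sub>R 1" "sqnorm c (- J) = n *\<^sub>R 1" "4 * n > (- t)\<^sup>2"
      by simp_all
    then show ?thesis
      unfolding quadratic_cone_def by blast
  qed
  then show ?thesis
    using J by (simp add: imag_sphere_def nonassoc_times_simps)
qed

lemma unit_elem_diff_uminus:
  fixes J :: "'a::real_nonassoc_algebra_1"
  assumes "J * J = - 1"
  shows "unit_elem (J - (- J))"
proof -
  have "J - (- J) = 2 *\<^sub>R J"
    by (simp add: scaleR_2)
  then show ?thesis
    unfolding unit_elem_def
    \<comment> \<open>\<open>- J\<close> is inverse to \<open>J\<close>, so half of it is inverse to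
      \<open>2J\<close>.\<close>
    by (intro exI[of _ "(- 1 / 2) *\<^sub>R J"]) (simp add: nonassoc_times_simps assms)
qed

lemma slice_half_plane_subset_slice_plane:
  assumes "K \<in> slice_plane J"
  shows "slice_half_plane K \<subseteq> slice_plane J"
  using assms unfolding slice_half_plane_def slice_plane_def
  by (auto intro: span_add span_scale span_base)

theorem proposition5:
  fixes c :: "'a::real_alternative_algebra_1 \<Rightarrow> 'a" and D :: "complex set"
  assumes "finite_dimensional TYPE('a)" and "dim (UNIV :: 'a set) > 1"
    and "antiinvolution c" and "imag_sphere c \<noteq> {}"
    and "open D" and "\<forall>z\<in>D. cnj z \<in> D"
  shows "(\<forall>J\<in>imag_sphere c. \<forall>K\<in>imag_sphere c. unit_elem (J - K) \<longrightarrow>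
            slice_half_plane J \<noteq> slice_half_plane K \<and>
            (\<forall>f g. slice_function c D f \<longrightarrow> slice_function c D g \<longrightarrow>
              (\<forall>x\<in>slice_half_plane J \<inter> slice_domain c D. f x = g x) \<longrightarrow>
              (\<forall>x\<in>slice_half_plane K \<inter> slice_domain c D. f x = g x) \<longrightarrow>
              (\<forall>x\<in>slice_domain c D. f x = g x)))
       \<and> (\<forall>J\<in>imag_sphere c. \<forall>f g. slice_function c D f \<longrightarrow> slice_function c D g \<longrightarrow>
              (\<forall>x\<in>slice_plane J \<inter> slice_domain c D. f x = g x) \<longrightarrow>
              (\<forall>x\<in>slice_domain c D. f x = g x))"
proof -
  have one: "(1::'a) \<noteq> 0"
    using assms(2) by (intro one_neq_zero_if_dim) simp
  have sq: "J * J = - 1" if "J \<in> imag_sphere c" for J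
    using that by (simp add: imag_sphere_def)
  have distinct: "slice_half_plane J \<noteq> slice_half_plane K"
    if "J \<in> imag_sphere c" "K \<in> imag_sphere c" "unit_elem (J - K)" for J K
  proof
    assume "slice_half_plane J = slice_half_plane K"
    then have "J = K"
      using slice_half_plane_inject[OF one] that sq by blast
    \<comment> \<open>\<open>J - K\<close> would be 0, which has no inverse because
      \<open>1 \<noteq> 0\<close>.\<close>
    then show False
      using that(3) one by (simp add: unit_elem_def nonassoc_times_simps)
  qed
  have plane: "f x = g x"
    if J: "J \<in> imag_sphere c" and fg: "slice_function c D f" "slice_function c D g"
      and eq: "\<forall>x\<in>slice_plane J \<inter> slice_domain c D. f x = g x"
      and x: "x \<in> slice_domain c D" for J f g x
  proof -
    \<comment> \<open>The plane contains the half planes of both \<open>J\<close> and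
      \<open>- J\<close>, which reduces the claim to two half planes.\<close>
    have "J \<in> slice_plane J" "- J \<in> slice_plane J"
      by (simp_all add: slice_plane_def span_base span_neg)
    then have "slice_half_plane J \<subseteq> slice_plane J" "slice_half_plane (- J) \<subseteq> slice_plane J"
      by (auto dest: slice_half_plane_subset_slice_plane)
    then have "\<forall>x\<in>slice_half_plane J \<inter> slice_domain c D. f x = g x"
      "\<forall>x\<in>slice_half_plane (- J) \<inter> slice_domain c D. f x = g x"
      using eq by blast+
    then show ?thesis
      using slice_functions_eq_if_eq_on_half_planes[OF assms(6) J uminus_imag_sphere[OF assms(3) J]
          unit_elem_diff_uminus[OF sq[OF J]] fg] x by blast
  qed
  show ?thesis
    using distinct plane slice_functions_eq_if_eq_on_half_planes[OF assms(6)] by (intro conjI) blast+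
qed

end
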